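(* Let $\phi(R_1, \ldots, R_n)$ denote a factor all of whose arguments have the same range. Then the size of any subset of commutative arguments of $\phi$ (i.e., $|\boldsymbol S|$ for any $\boldsymbol S \subseteq \{R_1,\ldots,R_n\}$ such that $\phi$ is commutative with respect to $\boldsymbol S$) is upper-bounded by $$\min_{b \in \{b \,\mid\, b \in \mathcal B(\phi) \,\land\, |\phi(b)| > 1\}} \ \max_{\varphi \in \phi(b)} \mathrm{count}(\phi(b), \varphi),$$ where $\mathrm{count}(\phi(b), \varphi)$ denotes the number of occurrences of the potential $\varphi$ in $\phi(b)$.
   Context: A factor $\phi(R_1,\ldots,R_n)$ is a function that maps each assignment $(r_1,\ldots,r_n) \in \times_{i=1}^n \mathrm{range}(R_i)$ of its arguments (random variables $R_i$ with finite sets of possible values $\mathrm{range}(R_i)$) to a positive real number, called a potential. All arguments are assumed to have the same range $\mathcal V$. Commutative: $\phi$ is commutative with respect to $\boldsymbol S \subseteq \{R_1, \ldots, R_n\}$ if for all $(r_1, \ldots, r_n) \in \times_{i=1}^n \mathrm{range}(R_i)$ it holds that $\phi(r_1, \ldots, r_n) = \phi(r_{\pi(1)}, \ldots, r_{\pi(n)})$ for all permutations $\pi$ of $\{1, \ldots, n\}$ with $\pi(i) = i$ for all $R_i \notin \boldsymbol S$. Bucket: a bucket $b$ entailed by $\phi$ (i.e., by its full argument set) is a set of pairs $\{(v, n_v)\}_{v \in \mathcal V}$ with $n_v \in \mathbb{N}$ (zero allowed) and $\sum_v n_v = n$; it represents all assignments $(r_1,\ldots,r_n)$ in which each value $v$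 occurs exactly $n_v$ times. $\phi(b)$ denotes the multiset of potentials to which $\phi$ maps the assignments represented by $b$ (one element per assignment), and $|\phi(b)|$ is its size with multiplicity. $\mathcal B(\phi)$ denotes the set of all buckets entailed by $\phi$. Convention: a minimum over an empty set of buckets is $+\infty$. *)

theory Defs
  imports
    "HOL-Library.Multiset"
    "HOL-Library.FuncSet"
    "HOL-Library.Extended_Nat"
    "HOL-Combinatorics.Permutations"
begin

text \<open>
  The arguments \<open>R\<^sub>1, \<dots>, R\<^sub>n\<close> are represented by their indices \<open>1, \<dots>, n\<close>, so a set of
  arguments is a set \<open>S \<subseteq> {1..n}\<close>. All arguments share the range \<open>V\<close>, and an assignment
  \<open>(r\<^sub>1, \<dots>, r\<^sub>n)\<close> is an extensional function on \<open>{1..n}\<close>, so that distinct assignments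
  are distinct functions and counting assignments is meaningful.
\<close>

definition assignments :: "nat \<Rightarrow> 'v set \<Rightarrow> (nat \<Rightarrow> 'v) set" where
  "assignments n V = ({1..n} \<rightarrow>\<^sub>E V)"

definition is_factor :: "nat \<Rightarrow> 'v set \<Rightarrow> ((nat \<Rightarrow> 'v) \<Rightarrow> real) \<Rightarrow> bool" where
  "is_factor n V \<phi> \<longleftrightarrow> finite V \<and> (\<forall>r\<in>assignments n V. \<phi> r > 0)"

text \<open>
  Since \<open>\<pi> permutes {1..n}\<close> fixes everything outside \<open>{1..n}\<close>, the function \<open>\<lambda>i. r (\<pi> i)\<close>
  is again an extensional assignment.
\<close>

definition commutative_wrt ::
  "nat \<Rightarrow> 'v set \<Rightarrow> ((nat \<Rightarrow> 'v) \<Rightarrow> real) \<Rightarrow> nat set \<Rightarrow> bool" where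
  "commutative_wrt n V \<phi> S \<longleftrightarrow>
     (\<forall>r\<in>assignments n V. \<forall>\<pi>.
        \<pi> permutes {1..n} \<and> (\<forall>i\<in>{1..n} - S. \<pi> i = i) \<longrightarrow> \<phi> r = \<phi> (\<lambda>i. r (\<pi> i)))"

definition buckets :: "nat \<Rightarrow> 'v set \<Rightarrow> ('v \<times> nat) set set" where
  "buckets n V = {{(v, c v) | v. v \<in> V} | c. (\<Sum>v\<in>V. c v) = n}"

definition bucket_assignments ::
  "nat \<Rightarrow> 'v set \<Rightarrow> ('v \<times> nat) set \<Rightarrow> (nat \<Rightarrow> 'v) set" where
  "bucket_assignments n V b =
     {r \<in> assignments n V. \<forall>(v, k)\<in>b. card {i \<in> {1..n}. r i = v} = k}"

definition bucket_potentials ::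
  "nat \<Rightarrow> 'v set \<Rightarrow> ((nat \<Rightarrow> 'v) \<Rightarrow> real) \<Rightarrow> ('v \<times> nat) set \<Rightarrow> real multiset" where
  "bucket_potentials n V \<phi> b = image_mset \<phi> (mset_set (bucket_assignments n V b))"

text \<open>
  A minimum over buckets is rendered as an infimum in \<^typ>\<open>enat\<close>: it is attained for a nonempty family
  and equals \<open>\<infinity>\<close> for the empty one. A maximum over the
  potentials of a bucket \<open>b\<close> with \<open>|\<phi>(b)| > 1\<close> is a \<^const>\<open>Max\<close> over a finite nonempty set.
\<close>

end

theory Submission imports Defs begin

text \<open>
  A bucket with more than one assignment contains an assignment that is not constant on \<open>S\<close>
  (if \<open>|S| \<ge> 2\<close>). If such an assignment takes some value at exactly \<open>a\<close> arguments in \<open>S\<close> and other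
  values at the remaining \<open>b \<ge> 1\<close> ones, then swapping an argument of the first kind with one of the
  second kind produces \<open>a * b\<close> new assignments. Together with the original one, these are
  \<open>a * b + 1 \<ge> a + b = |S|\<close> assignments in the bucket sharing one potential.
\<close>

lemma card_le_card_rearrangements:
  assumes fin: "finite S" and pq: "p0 \<in> S" "q0 \<in> S" "r p0 \<noteq> r q0"
  shows "card S \<le> card ((\<lambda>\<pi>. r \<circ> \<pi>) ` {\<pi>. \<pi> permutes S})"
proof -
  define A where "A = {i \<in> S. r i = r p0}"
  define B where "B = {i \<in> S. r i \<noteq> r p0}"
  define f where "f = (\<lambda>(p, q). r \<circ> transpose p q)"
  have finAB: "finite A" "finite B" using fin by (auto simp: A_def B_def)
  have S: "S = A \<union> B" "A \<inter> B = {}" by (auto simp: A_def B_def)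
  \<comment> \<open>The positions in \<open>S\<close> where \<open>r \<circ> transpose p q\<close>
    takes the value \<open>r p0\<close> are \<open>A\<close> with \<open>p\<close> replaced by
    \<open>q\<close>. So \<open>p\<close> is the only element of \<open>A\<close> lost and
    \<open>q\<close> the only one gained: the pair can be read off from \<open>f (p, q)\<close>,
    which makes \<open>f\<close> injective.\<close>
  have level: "{i \<in> S. f (p, q) i = r p0} = insert q (A - {p})" if "p \<in> A" "q \<in> B" for p q
    using that by (auto simp: f_def A_def B_def transpose_def split: if_splits)
  have inj: "inj_on f (A \<times> B)"
  proof (rule inj_onI, clarify)
    fix p q p' q' assume *: "p \<in> A" "q \<in> B" "p' \<in> A" "q' \<in> B" "f (p, q) = f (p', q')"
    then have eq: "insert q (A - {p}) = insert q' (A - {p'})"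
      using level[of p q] level[of p' q'] by simp
    have "p \<notin> insert q (A - {p})" "q \<notin> A" "p' \<notin> insert q' (A - {p'})"
      using * S(2) by auto
    with eq *(1,3) show "p = p' \<and> q = q'"
      by (metis Diff_iff insertCI insertE singletonD)
  qed
  have notin: "r \<notin> f ` (A \<times> B)"
  proof
    assume "r \<in> f ` (A \<times> B)"
    then obtain p q where pq': "p \<in> A" "q \<in> B" "r = f (p, q)" by auto
    then have "r p = r q" by (metis (mono_tags, lifting) case_prod_conv comp_apply f_def transpose_apply_first)
    with pq' show False by (auto simp: A_def B_def)
  qed
  have "1 \<le> card A" "1 \<le> card B"
    using finAB pq by (auto simp: Suc_le_eq card_gt_0_iff A_def B_def)
  \<comment> \<open>For sizes a + 1 and b + 1, the product plus one exceeds the sum by exactly a *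
    b, so positivity of both cardinalities is what the inequality rests on.\<close>
  then obtain a b where "card A = Suc a" "card B = Suc b"
    by (metis One_nat_def Suc_le_D)
  then have "card A + card B \<le> Suc (card A * card B)" by simp
  moreover have "card S = card A + card B"
    using finAB S by (simp add: card_Un_disjoint)
  moreover have "card (insert r (f ` (A \<times> B))) = Suc (card A * card B)"
    using finAB inj notin by (simp add: card_image card_cartesian_product)
  moreover have "card (insert r (f ` (A \<times> B))) \<le> card ((\<lambda>\<pi>. r \<circ> \<pi>) ` {\<pi>. \<pi> permutes S})"
  proof (rule card_mono)
    show "finite ((\<lambda>\<pi>. r \<circ> \<pi>) ` {\<pi>. \<pi> permutes S})"
      using fin by (simp add: finite_permutations)
    \<comment> \<open>The identity accounts for \<open>r\<close> itself, the transpositions for the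
      image of \<open>f\<close>; other permutations of \<open>S\<close> need not be counted.\<close>
    have "r \<circ> id \<in> (\<lambda>\<pi>. r \<circ> \<pi>) ` {\<pi>. \<pi> permutes S}"
      using permutes_id by blast
    moreover have "r \<circ> transpose p q \<in> (\<lambda>\<pi>. r \<circ> \<pi>) ` {\<pi>. \<pi> permutes S}"
      if "p \<in> S" "q \<in> S" for p q
      using permutes_swap_id[OF that] by blast
    ultimately show "insert r (f ` (A \<times> B)) \<subseteq> (\<lambda>\<pi>. r \<circ> \<pi>) ` {\<pi>. \<pi> permutes S}"
      by (auto simp: f_def A_def B_def)
  qed
  ultimately show ?thesis by linarith
qed

lemma finite_bucket_assignments:
  assumes "finite V"
  shows "finite (bucket_assignments n V b)"
  using assms by (simp add: bucket_assignments_def assignments_def finite_PiE)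

text \<open>The permutation maps each level set of \<open>r \<circ> \<pi>\<close> bijectively onto
  that of \<open>r\<close>, so every value keeps its number of occurrences. It fixes all indices
  outside \<open>{1..n}\<close>, so the result stays extensional.\<close>

lemma bucket_assignments_permute:
  assumes r: "r \<in> bucket_assignments n V b" and \<pi>: "\<pi> permutes {1..n}"
  shows "r \<circ> \<pi> \<in> bucket_assignments n V b"
proof -
  have "card {i \<in> {1..n}. (r \<circ> \<pi>) i = v} = card {i \<in> {1..n}. r i = v}" for v
  proof -
    have "\<pi> ` {i \<in> {1..n}. (r \<circ> \<pi>) i = v} = \<pi> ` (\<pi> -` {i \<in> {1..n}. r i = v})"
      using permutes_in_image[OF \<pi>] by (simp add: vimage_def del: atLeastAtMost_iff)
    also have "\<dots> = {i \<in> {1..n}. r i = v}"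
      using permutes_surj[OF \<pi>] by (rule surj_image_vimage_eq)
    finally have image: "\<pi> ` {i \<in> {1..n}. (r \<circ> \<pi>) i = v} = {i \<in> {1..n}. r i = v}" .
    have "inj_on \<pi> {i \<in> {1..n}. (r \<circ> \<pi>) i = v}"
      using permutes_inj[OF \<pi>] by (rule inj_on_subset) simp
    from card_image[OF this] show ?thesis unfolding image by (rule sym)
  qed
  moreover have "r \<circ> \<pi> \<in> assignments n V"
    unfolding assignments_def
  proof (rule PiE_I)
    have ext: "r \<in> {1..n} \<rightarrow>\<^sub>E V"
      using r by (simp add: bucket_assignments_def assignments_def)
    fix i
    show "(r \<circ> \<pi>) i \<in> V" if "i \<in> {1..n}"
      using PiE_mem[OF ext] permutes_in_image[OF \<pi>] that by (simp del: atLeastAtMost_iff)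
    show "(r \<circ> \<pi>) i = undefined" if "i \<notin> {1..n}"
      using PiE_arb[OF ext that] permutes_not_in[OF \<pi> that] by simp
  qed
  ultimately show ?thesis using r by (simp add: bucket_assignments_def)
qed

text \<open>Take a position where the two assignments differ. The value of \<open>r'\<close> there
  must also occur in \<open>r\<close>, because both have the same value counts, and it can do so
  only at another position.\<close>

lemma bucket_assignment_not_constant:
  assumes b: "b \<in> buckets n V"
    and r: "r \<in> bucket_assignments n V b" and r': "r' \<in> bucket_assignments n V b"
    and "r \<noteq> r'"
  obtains p q where "p \<in> {1..n}" "q \<in> {1..n}" "r p \<noteq> r q"
proof -
  obtain c where c: "b = {(v, c v) | v. v \<in> V}" using b by (auto simp: buckets_def)
  have ext: "r \<in> {1..n} \<rightarrow>\<^sub>E V" "r' \<in> {1..n} \<rightarrow>\<^sub>E V"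
    using r r' by (auto simp: bucket_assignments_def assignments_def)
  with \<open>r \<noteq> r'\<close> obtain i where i: "i \<in> {1..n}" "r i \<noteq> r' i"
    by (metis PiE_ext)
  have "r' i \<in> V" using ext i by auto
  then have "card {j \<in> {1..n}. r j = r' i} = card {j \<in> {1..n}. r' j = r' i}"
    using r r' by (auto simp: bucket_assignments_def c)
  moreover have "card {j \<in> {1..n}. r' j = r' i} > 0"
    using i by (auto simp: card_gt_0_iff)
  ultimately have "{j \<in> {1..n}. r j = r' i} \<noteq> {}"
    by (metis card.empty less_irrefl)
  then obtain j where "j \<in> {1..n}" "r j = r' i" by blast
  with i that[of i j] show ?thesis by simp
qed

lemma card_le_count_image_mset_set:
  assumes "finite A" "T \<subseteq> A" "\<And>t. t \<in> T \<Longrightarrow> f t = x"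
  shows "card T \<le> count (image_mset f (mset_set A)) x"
proof -
  have "card T = count (image_mset f (mset_set T)) x"
  proof -
    have "image_mset f (mset_set T) = image_mset (\<lambda>_. x) (mset_set T)"
      using assms(3) finite_subset[OF assms(2,1)] by (intro image_mset_cong) auto
    then show ?thesis by (simp add: image_mset_const_eq)
  qed
  also have "\<dots> \<le> count (image_mset f (mset_set A)) x"
    using assms by (intro mset_subset_eq_count image_mset_subseteq_mono subset_imp_msubset_mset_set)
  finally show ?thesis .
qed

lemma card_commutative_le_count:
  assumes V: "finite V" and S: "S \<subseteq> {1..n}" and comm: "commutative_wrt n V \<phi> S"
    and b: "b \<in> buckets n V" and size: "size (bucket_potentials n V \<phi> b) > 1"
  obtains x where "x \<in># bucket_potentials n V \<phi> b" "card S \<le> count (bucket_potentials n V \<phi> b) x"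
proof -
  let ?A = "bucket_assignments n V b"
  have finA: "finite ?A" using V by (rule finite_bucket_assignments)
  have finS: "finite S" using S finite_subset by blast
  have "card ?A > 1" using size by (simp add: bucket_potentials_def)
  then obtain r r' where rr': "r \<in> ?A" "r' \<in> ?A" "r \<noteq> r'"
    by (metis One_nat_def card_le_Suc0_iff_eq finA not_less)
  show thesis
  proof (cases "card S \<le> 1")
    \<comment> \<open>Rearranging requires two distinct arguments in \<open>S\<close>. For smaller
      \<open>S\<close>, it suffices that every potential of the bucket occurs at least once.\<close>
    case True
    have mem: "\<phi> r \<in># bucket_potentials n V \<phi> b"
      using rr' finA by (simp add: bucket_potentials_def)
    then have "1 \<le> count (bucket_potentials n V \<phi> b) (\<phi> r)"
      by (simp add: Suc_le_eq)
    with True have "card S \<le> count (bucket_potentials n V \<phi> b) (\<phi> r)" by linarith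
    with mem show thesis by (rule that)
  next
    case False
    then obtain i j where ij: "i \<in> S" "j \<in> S" "i \<noteq> j"
      using finS by (metis One_nat_def card_le_Suc0_iff_eq)
    obtain s p q where s: "s \<in> ?A" "p \<in> S" "q \<in> S" "s p \<noteq> s q"
    proof (cases "\<forall>k\<in>S. r k = r i")
      case True
      \<comment> \<open>One of two positions with different values must differ from
        \<open>r i\<close>; as \<open>r\<close> is constant on \<open>S\<close>, this
        \<open>k\<close> lies outside \<open>S\<close>. Swapping \<open>i\<close> and
        \<open>k\<close> brings the foreign value into \<open>S\<close>, while \<open>j\<close>
        keeps the old one.\<close>
      obtain k where k: "k \<in> {1..n}" "r k \<noteq> r i"
      proof (rule bucket_assignment_not_constant[OF b rr'])
        fix p q assume "p \<in> {1..n}" "q \<in> {1..n}" "r p \<noteq> r q"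
        then show thesis using that by (cases "r p = r i") auto
      qed
      have "r j = r i" using True ij by blast
      then have jk: "j \<noteq> k" using k by metis
      have "i \<in> {1..n}" using ij(1) S by blast
      then have "r \<circ> transpose i k \<in> ?A"
        using rr'(1) k(1) by (intro bucket_assignments_permute permutes_swap_id)
      moreover have "(r \<circ> transpose i k) i \<noteq> (r \<circ> transpose i k) j"
        using ij(3) jk k(2) \<open>r j = r i\<close> by (simp add: transpose_def)
      ultimately show thesis using ij(1,2) by (intro that)
    next
      case False
      then obtain k where "k \<in> S" "r k \<noteq> r i" by blast
      with rr'(1) ij(1) show thesis by (intro that)
    qed
    let ?T = "(\<lambda>\<pi>. s \<circ> \<pi>) ` {\<pi>. \<pi> permutes S}"
    have "?T \<subseteq> ?A"
      using bucket_assignments_permute[OF s(1)] permutes_subset[OF _ S] by blast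
    \<comment> \<open>A permutation of \<open>S\<close>, seen as one of \<open>{1..n}\<close>, fixes
      every argument outside \<open>S\<close>, so commutativity applies to it.\<close>
    moreover have "\<phi> t = \<phi> s" if "t \<in> ?T" for t
    proof -
      obtain \<pi> where \<pi>: "\<pi> permutes S" "t = s \<circ> \<pi>" using \<open>t \<in> ?T\<close> by blast
      have "\<pi> permutes {1..n}" "\<forall>i\<in>{1..n} - S. \<pi> i = i"
        using permutes_subset[OF \<pi>(1) S] permutes_not_in[OF \<pi>(1)] by simp_all
      then have "\<phi> s = \<phi> (\<lambda>i. s (\<pi> i))"
        using comm s(1) unfolding commutative_wrt_def bucket_assignments_def by blast
      then show ?thesis by (simp add: \<pi>(2) comp_def)
    qed
    ultimately have le: "card ?T \<le> count (bucket_potentials n V \<phi> b) (\<phi> s)"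
      unfolding bucket_potentials_def by (intro card_le_count_image_mset_set finA)
    have "card S \<le> card ?T"
      using finS s(2-4) by (rule card_le_card_rearrangements)
    also note le
    finally have "card S \<le> count (bucket_potentials n V \<phi> b) (\<phi> s)" .
    moreover have "\<phi> s \<in># bucket_potentials n V \<phi> b"
      using s(1) finA by (simp add: bucket_potentials_def)
    ultimately show thesis by (intro that)
  qed
qed

theorem corollary6:
  fixes n :: nat and V :: "'v set" and \<phi> :: "(nat \<Rightarrow> 'v) \<Rightarrow> real" and S :: "nat set"
  assumes "is_factor n V \<phi>"
    and "S \<subseteq> {1..n}"
    and "commutative_wrt n V \<phi> S"
  shows "enat (card S) \<le>
    (INF b\<in>{b. b \<in> buckets n V \<and> size (bucket_potentials n V \<phi> b) > 1}.
       enat (Max ((\<lambda>x. count (bucket_potentials n V \<phi> b) x) `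
                    set_mset (bucket_potentials n V \<phi> b))))"
proof (rule INF_greatest, clarify)
  \<comment> \<open>Bounding each bucket separately also covers the empty family, whose infimum is
    \<infinity>. In each bucket, one potential that occurs often enough bounds the maximum from
    below.\<close>
  fix b assume b: "b \<in> buckets n V" "size (bucket_potentials n V \<phi> b) > 1"
  have "finite V" using assms(1) by (simp add: is_factor_def)
  from card_commutative_le_count[OF this assms(2,3) b]
  obtain x where x: "x \<in># bucket_potentials n V \<phi> b"
    "card S \<le> count (bucket_potentials n V \<phi> b) x" .
  note x(2)
  also have "count (bucket_potentials n V \<phi> b) x \<le>
      Max (count (bucket_potentials n V \<phi> b) ` set_mset (bucket_potentials n V \<phi> b))"
    using x(1) by (intro Max_ge) auto
  finally show "enat (card S) \<le>
      enat (Max (count (bucket_potentials n V \<phi> b) ` set_mset (bucket_potentials n V \<phi> b)))"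
    by (simp only: enat_ord_simps)
qed

end
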